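(* Let $N\ge3$ be an integer and $p=q>1$. Then all the radial solutions of the system $-\Delta u_1=|\nabla u_2|^q$, $-\Delta u_2=|\nabla u_1|^q$ satisfy, in any interval of definition, the first integral $$|u_1'|^qu_1'-|u_2'|^qu_2'\equiv C\,r^{(1-N)(q+1)}$$ for some $C\in\mathbb{R}$, and can be computed by quadratures. All the radial solutions $(u_1,u_2)$ in $\mathbb{R}^N\setminus\{0\}$ satisfy, up to an additive constant, $u_1\equiv u_2\equiv u$ (that is, $u_1-u_2$ is constant), where $u$ is any radial solution in $\mathbb{R}^N\setminus\{0\}$ of the scalar equation $-\Delta u=|\nabla u|^q$.
   Context: Here $r=|x|$, $'=d/dr$; solutions are $C^2$, with no condition of sign. *)

theory Defs
  imports "HOL-Analysis.Analysis"
begin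

definition pderivative :: "'a::euclidean_space \<Rightarrow> ('a \<Rightarrow> real) \<Rightarrow> 'a \<Rightarrow> real" where
  "pderivative i u x = frechet_derivative u (at x) i"

definition gradient :: "('a::euclidean_space \<Rightarrow> real) \<Rightarrow> 'a \<Rightarrow> 'a" where
  "gradient u x = (\<Sum>i\<in>Basis. pderivative i u x *\<^sub>R i)"

definition laplacian :: "('a::euclidean_space \<Rightarrow> real) \<Rightarrow> 'a \<Rightarrow> real" where
  "laplacian u x = (\<Sum>i\<in>Basis. pderivative i (pderivative i u) x)"

text \<open>Meant for open \<open>S\<close>: all derivatives are taken at full neighbourhoods of the points of \<open>S\<close>.\<close>

definition C2_on :: "'a::euclidean_space set \<Rightarrow> ('a \<Rightarrow> real) \<Rightarrow> bool" where
  "C2_on S u \<longleftrightarrow>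
     (\<forall>x\<in>S. u differentiable (at x)) \<and>
     (\<forall>i\<in>Basis. \<forall>x\<in>S. pderivative i u differentiable (at x)) \<and>
     (\<forall>i\<in>Basis. \<forall>j\<in>Basis. continuous_on S (pderivative j (pderivative i u)))"

definition scalar_solution :: "real \<Rightarrow> 'a::euclidean_space set \<Rightarrow> ('a \<Rightarrow> real) \<Rightarrow> bool" where
  "scalar_solution q S u \<longleftrightarrow>
     C2_on S u \<and> (\<forall>x\<in>S. - laplacian u x = norm (gradient u x) powr q)"

definition system_solution ::
    "real \<Rightarrow> real \<Rightarrow> 'a::euclidean_space set \<Rightarrow> ('a \<Rightarrow> real) \<Rightarrow> ('a \<Rightarrow> real) \<Rightarrow> bool" where
  "system_solution p q S u1 u2 \<longleftrightarrow>
     C2_on S u1 \<and> C2_on S u2 \<and>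
     (\<forall>x\<in>S. - laplacian u1 x = norm (gradient u2 x) powr p) \<and>
     (\<forall>x\<in>S. - laplacian u2 x = norm (gradient u1 x) powr q)"

definition radial_profile :: "'a::real_normed_vector set \<Rightarrow> ('a \<Rightarrow> real) \<Rightarrow> (real \<Rightarrow> real) \<Rightarrow> bool" where
  "radial_profile S u v \<longleftrightarrow> (\<forall>x\<in>S. u x = v (norm x))"

definition radial_on :: "'a::real_normed_vector set \<Rightarrow> ('a \<Rightarrow> real) \<Rightarrow> bool" where
  "radial_on S u \<longleftrightarrow> (\<exists>v. radial_profile S u v)"

text \<open>
  Write \<open>w\<^sub>i = r\<^bsup>N-1\<^esup> u\<^sub>i'\<close>. The radial system is
  \<open>w\<^sub>1' = - r\<^bsup>(N-1)(1-q)\<^esup> |w\<^sub>2|\<^bsup>q\<^esup>\<close>, \<open>w\<^sub>2' = - r\<^bsup>(N-1)(1-q)\<^esup> |w\<^sub>1|\<^bsup>q\<^esup>\<close>,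
  and the first integral reads \<open>|w\<^sub>1|\<^bsup>q\<^esup> w\<^sub>1 - |w\<^sub>2|\<^bsup>q\<^esup> w\<^sub>2 = C\<close>. Eliminating \<open>w\<^sub>2\<close> leaves
  the separable equation
  \<open>w\<^sub>1' = - r\<^bsup>(N-1)(1-q)\<^esup> | |w\<^sub>1|\<^bsup>q\<^esup> w\<^sub>1 - C |\<^bsup>q/(q+1)\<^esup>\<close>.
  The relation below is its integrated form: \<open>y\<close> is the value \<open>w\<^sub>1(r)\<close> when \<open>w\<^sub>1(r\<^sub>0) = A\<close>.
  The integrand in \<open>t\<close> may have a singularity, at \<open>|t|\<^bsup>q\<^esup> t = C\<close>; it is integrable
  if \<open>C \<noteq> 0\<close>, and not if \<open>C = 0\<close>. For \<open>C = A = 0\<close> both components vanish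
  identically and the separation of variables does not apply.
\<close>

definition flux_quadrature ::
    "nat \<Rightarrow> real \<Rightarrow> real \<Rightarrow> real \<Rightarrow> real \<Rightarrow> real \<Rightarrow> real \<Rightarrow> bool" where
  "flux_quadrature N q C r0 A r y \<longleftrightarrow>
     (if C = 0 \<and> A = 0 then y = 0
      else interval_lebesgue_integrable lborel (ereal A) (ereal y)
             (\<lambda>t. \<bar>\<bar>t\<bar> powr q * t - C\<bar> powr (- (q / (q + 1)))) \<and>
           (LBINT t=ereal A..ereal y. \<bar>\<bar>t\<bar> powr q * t - C\<bar> powr (- (q / (q + 1)))) =
             - (LBINT s=ereal r0..ereal r. s powr ((real N - 1) * (1 - q))))"

definition signed_root :: "real \<Rightarrow> real \<Rightarrow> real" where
  "signed_root m z = sgn z * \<bar>z\<bar> powr (1 / m)"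

text \<open>
  The profiles are obtained from the constants \<open>C\<close>, \<open>w\<^sub>1(r\<^sub>0)\<close>, \<open>v\<^sub>1(r\<^sub>0)\<close>, \<open>v\<^sub>2(r\<^sub>0)\<close> alone:
  \<open>w\<^sub>1\<close> by inverting an integral (with exactly one possible value at each \<open>r\<close>), \<open>w\<^sub>2\<close>
  algebraically from the first integral, and \<open>v\<^sub>1\<close>, \<open>v\<^sub>2\<close> by one more integration.
\<close>

definition given_by_quadratures ::
    "nat \<Rightarrow> real \<Rightarrow> real set \<Rightarrow> real \<Rightarrow> (real \<Rightarrow> real) \<Rightarrow> (real \<Rightarrow> real) \<Rightarrow> bool" where
  "given_by_quadratures N q I C v1 v2 \<longleftrightarrow>
     (\<forall>r0\<in>I. \<exists>w1 w2.
        (\<forall>r\<in>I. \<forall>y. flux_quadrature N q C r0 (r0 ^ (N - 1) * deriv v1 r0) r y \<longleftrightarrow> y = w1 r) \<and>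
        (\<forall>r\<in>I. w2 r = signed_root (q + 1) (\<bar>w1 r\<bar> powr q * w1 r - C)) \<and>
        (\<forall>r\<in>I. interval_lebesgue_integrable lborel (ereal r0) (ereal r) (\<lambda>s. w1 s / s ^ (N - 1)) \<and>
                v1 r = v1 r0 + (LBINT s=ereal r0..ereal r. w1 s / s ^ (N - 1))) \<and>
        (\<forall>r\<in>I. interval_lebesgue_integrable lborel (ereal r0) (ereal r) (\<lambda>s. w2 s / s ^ (N - 1)) \<and>
                v2 r = v2 r0 + (LBINT s=ereal r0..ereal r. w2 s / s ^ (N - 1))))"

end

theory Submission
  imports Defs "HOL-Real_Asymp.Real_Asymp"
begin

text \<open>
  In terms of the fluxes \<open>w\<^sub>i = r\<^bsup>N-1\<^esup> u\<^sub>i'\<close> a radial solution satisfies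
  \<open>w\<^sub>1' = - k |w\<^sub>2|\<^sup>q\<close>, \<open>w\<^sub>2' = - k |w\<^sub>1|\<^sup>q\<close> with the weight \<open>k = r\<^bsup>(N-1)(1-q)\<^esup>\<close>, since
  \<open>r\<^bsup>N-1\<^esup> \<Delta>u\<^sub>i = w\<^sub>i'\<close> and \<open>|\<nabla>u\<^sub>i| = |u\<^sub>i'|\<close>. The signed powers \<open>|w\<^sub>i|\<^sup>q w\<^sub>i\<close> have equal
  derivatives, so their difference is a constant \<open>C\<close>; divided by \<open>r\<^bsup>(N-1)(q+1)\<^esup>\<close>, this is the
  first integral.

  The quadrature is the change of variables \<open>t = w\<^sub>1(s)\<close>, which transforms
  \<open>||t|\<^sup>q t - C|\<^bsup>-q/(q+1)\<^esup> dt = |w\<^sub>2|\<^bsup>-q\<^esup> dw\<^sub>1\<close> into \<open>- k ds\<close>. It is legitimate because a non-trivial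
  solution has at most one zero of \<open>w\<^sub>2\<close>, which makes \<open>w\<^sub>1\<close> strictly decreasing
  (\<open>zero_of_w2_unique\<close>, \<open>strict_antimono_w1\<close>); this uses both equations of the system, as the
  scalar equation for \<open>w\<^sub>1\<close> alone is not Lipschitz there when \<open>C \<noteq> 0\<close>. The value is unique
  because the integrand is positive off one point (\<open>interval_integral_inject\<close>).

  If the solution is defined on all of \<open>(0, \<infinity>)\<close>, then \<open>C = 0\<close> (\<open>constant_zero_of_global\<close>): for
  \<open>C \<noteq> 0\<close> the sum \<open>w\<^sub>1 + w\<^sub>2\<close> decreases at a rate that is bounded below by multiples of \<open>k\<close> and of
  \<open>k |w\<^sub>1 + w\<^sub>2|\<^sup>q\<close>, so it blows up after a finite amount of the time \<open>\<integral> k\<close>, while this time is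
  infinite towards \<open>0\<close> or towards \<open>\<infinity>\<close>. And \<open>C = 0\<close> means \<open>u\<^sub>1' = u\<^sub>2'\<close>, so both components solve
  the scalar equation.
\<close>

section \<open>Signed powers\<close>

lemma has_real_derivative_odd_powr:
  fixes q t :: real
  assumes "q > 0"
  shows "((\<lambda>t. \<bar>t\<bar> powr q * t) has_real_derivative (q + 1) * \<bar>t\<bar> powr q) (at t)"
proof -
  consider "t > 0" | "t < 0" | "t = 0" by linarith
  then show ?thesis
  proof cases
    case 1
    have "((\<lambda>t. t powr q * t) has_real_derivative (q + 1) * \<bar>t\<bar> powr q) (at t)"
      using 1 by (auto intro!: derivative_eq_intros simp: powr_diff field_simps)
    then show ?thesis
      by (rule has_field_derivative_transform_within_open[where S = "{0<..}"]) (use 1 in auto)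
  next
    case 2
    have "((\<lambda>t. (- t) powr q * t) has_real_derivative (q + 1) * \<bar>t\<bar> powr q) (at t)"
      using 2 by (auto intro!: derivative_eq_intros simp: powr_diff field_simps)
    then show ?thesis
      by (rule has_field_derivative_transform_within_open[where S = "{..<0}"]) (use 2 in auto)
  next
    case 3
    \<comment> \<open>At the origin the difference quotient is itself \<open>|h|\<^sup>q\<close>, which tends to \<open>0\<close> because \<open>q > 0\<close>.\<close>
    have "((\<lambda>h::real. \<bar>h\<bar> powr q) \<longlongrightarrow> \<bar>0\<bar> powr q) (at 0)"
      using assms by (intro tendsto_powr' tendsto_intros) auto
    then have "((\<lambda>h::real. (\<bar>h\<bar> powr q * h) / h) \<longlongrightarrow> 0) (at 0)"
      by (rule filterlim_cong[THEN iffD1, rotated -1])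
        (use assms in \<open>auto simp: eventually_at_filter\<close>)
    then show ?thesis
      using 3 by (simp add: DERIV_def)
  qed
qed

lemma abs_odd_powr:
  fixes q t :: real
  shows "\<bar>\<bar>t\<bar> powr q * t\<bar> = \<bar>t\<bar> powr (q + 1)"
  by (cases "t = 0") (auto simp: abs_mult powr_add)

lemma signed_root_odd_powr:
  fixes q t :: real
  assumes "q > 0"
  shows "signed_root (q + 1) (\<bar>t\<bar> powr q * t) = t"
proof -
  have "\<bar>\<bar>t\<bar> powr q * t\<bar> powr (1 / (q + 1)) = \<bar>t\<bar>"
    using assms by (simp add: abs_odd_powr powr_powr)
  moreover have "sgn (\<bar>t\<bar> powr q * t) = sgn t"
    by (cases "t = 0") (auto simp: sgn_mult)
  ultimately show ?thesis
    by (simp add: signed_root_def sgn_mult_abs)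
qed

lemma odd_powr_eq_iff:
  fixes q s t :: real
  assumes "q > 0"
  shows "\<bar>s\<bar> powr q * s = \<bar>t\<bar> powr q * t \<longleftrightarrow> s = t"
  by (metis assms signed_root_odd_powr)

text \<open>
  A non-zero first integral keeps the pair \<open>(x, y)\<close> away from the origin: one of
  \<open>|x|\<^bsup>q+1\<^esup>\<close>, \<open>|y|\<^bsup>q+1\<^esup>\<close> is at least \<open>|C| / 2\<close>.
\<close>

lemma sum_powr_ge_const:
  fixes q x y C :: real
  assumes "\<bar>x\<bar> powr q * x - \<bar>y\<bar> powr q * y = C" and "q > 0"
  shows "(\<bar>C\<bar> / 2) powr (q / (q + 1)) \<le> \<bar>x\<bar> powr q + \<bar>y\<bar> powr q"
proof -
  have *: "(\<bar>C\<bar> / 2) powr (q / (q + 1)) \<le> \<bar>t\<bar> powr q" if "\<bar>C\<bar> / 2 \<le> \<bar>t\<bar> powr (q + 1)" for t :: real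
  proof -
    have "(\<bar>C\<bar> / 2) powr (q / (q + 1)) \<le> (\<bar>t\<bar> powr (q + 1)) powr (q / (q + 1))"
      using that \<open>q > 0\<close> by (intro powr_mono2) auto
    also have "\<dots> = \<bar>t\<bar> powr q" using \<open>q > 0\<close> by (simp add: powr_powr)
    finally show ?thesis .
  qed
  have "\<bar>C\<bar> \<le> \<bar>x\<bar> powr (q + 1) + \<bar>y\<bar> powr (q + 1)"
    using assms(1) abs_triangle_ineq4[of "\<bar>x\<bar> powr q * x" "\<bar>y\<bar> powr q * y"]
    by (simp only: abs_odd_powr)
  then have "\<bar>C\<bar> / 2 \<le> \<bar>x\<bar> powr (q + 1) \<or> \<bar>C\<bar> / 2 \<le> \<bar>y\<bar> powr (q + 1)"
    by linarith
  then show ?thesis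
    using *[of x] *[of y] powr_ge_zero[of "\<bar>x\<bar>" q] powr_ge_zero[of "\<bar>y\<bar>" q] by linarith
qed

text \<open>
  The larger of \<open>|x|\<close>, \<open>|y|\<close> is at least half of \<open>|x + y|\<close>. This turns the two equations of
  the system into a single superlinear inequality for the sum of the unknowns.
\<close>

lemma sum_powr_ge_powr_sum:
  fixes q x y :: real
  assumes "q > 0"
  shows "(1 / 2) powr q * \<bar>x + y\<bar> powr q \<le> \<bar>x\<bar> powr q + \<bar>y\<bar> powr q"
proof -
  have *: "(1 / 2) powr q * \<bar>x + y\<bar> powr q \<le> \<bar>t\<bar> powr q" if "\<bar>x + y\<bar> \<le> 2 * \<bar>t\<bar>" for t
  proof -
    have "(1 / 2) powr q * \<bar>x + y\<bar> powr q = (1 / 2 * \<bar>x + y\<bar>) powr q"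
      by (simp add: powr_mult powr_divide)
    also have "\<dots> \<le> \<bar>t\<bar> powr q"
      using that assms by (intro powr_mono2) auto
    finally show ?thesis .
  qed
  have "\<bar>x + y\<bar> \<le> 2 * \<bar>x\<bar> \<or> \<bar>x + y\<bar> \<le> 2 * \<bar>y\<bar>" by linarith
  then show ?thesis
    using *[of x] *[of y] powr_ge_zero[of "\<bar>x\<bar>" q] powr_ge_zero[of "\<bar>y\<bar>" q] by linarith
qed

section \<open>Differential inequalities\<close>

text \<open>
  Gronwall's argument: \<open>f\<^sup>2\<close> times a suitable exponential does not increase in the direction that leads
  from \<open>a\<close> to \<open>b\<close>. The point \<open>b\<close> may lie on either side of \<open>a\<close>.
\<close>

lemma zero_of_linear_growth:
  fixes f f' :: "real \<Rightarrow> real"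
  assumes der: "\<And>t. t \<in> closed_segment a b \<Longrightarrow> (f has_real_derivative f' t) (at t)"
    and bound: "\<And>t. t \<in> closed_segment a b \<Longrightarrow> \<bar>f' t\<bar> \<le> M * \<bar>f t\<bar>"
    and "f a = 0"
  shows "f b = 0"
proof -
  have key: "\<bar>f t * f' t\<bar> \<le> M * (f t)\<^sup>2" if "t \<in> closed_segment a b" for t
    using mult_left_mono[OF bound[OF that], of "\<bar>f t\<bar>"]
    by (simp add: abs_mult power2_eq_square algebra_simps)
  show ?thesis
  proof (cases "a \<le> b")
    case True
    have "exp (- 2 * M * b) * (f b)\<^sup>2 \<le> exp (- 2 * M * a) * (f a)\<^sup>2"
    proof (rule DERIV_nonpos_imp_nonincreasing[OF True], intro exI conjI)
      fix t assume "a \<le> t" "t \<le> b"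
      then have t: "t \<in> closed_segment a b"
        using True by (simp add: closed_segment_eq_real_ivl)
      show "((\<lambda>t. exp (- 2 * M * t) * (f t)\<^sup>2) has_real_derivative
          exp (- 2 * M * t) * (2 * (f t * f' t - M * (f t)\<^sup>2))) (at t)"
        by (rule derivative_eq_intros der[OF t] refl | simp add: algebra_simps)+
      show "exp (- 2 * M * t) * (2 * (f t * f' t - M * (f t)\<^sup>2)) \<le> 0"
        using key[OF t] by (auto simp: mult_le_0_iff)
    qed
    then show ?thesis using \<open>f a = 0\<close> by (simp add: mult_le_0_iff)
  next
    case False
    then have ba: "b \<le> a" by simp
    have "exp (2 * M * b) * (f b)\<^sup>2 \<le> exp (2 * M * a) * (f a)\<^sup>2"
    proof (rule DERIV_nonneg_imp_nondecreasing[OF ba], intro exI conjI)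
      fix t assume "b \<le> t" "t \<le> a"
      then have t: "t \<in> closed_segment a b"
        using False by (simp add: closed_segment_eq_real_ivl)
      show "((\<lambda>t. exp (2 * M * t) * (f t)\<^sup>2) has_real_derivative
          exp (2 * M * t) * (2 * (f t * f' t + M * (f t)\<^sup>2))) (at t)"
        by (rule derivative_eq_intros der[OF t] refl | simp add: algebra_simps)+
      show "0 \<le> exp (2 * M * t) * (2 * (f t * f' t + M * (f t)\<^sup>2))"
        using key[OF t] by (auto simp: zero_le_mult_iff)
    qed
    then show ?thesis using \<open>f a = 0\<close> by (simp add: mult_le_0_iff)
  qed
qed

lemma filterlim_at_top_of_deriv_ge:
  fixes f f' K k :: "real \<Rightarrow> real"
  assumes f: "\<And>s. s \<ge> a \<Longrightarrow> (f has_real_derivative f' s) (at s)"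
    and K: "\<And>s. s \<ge> a \<Longrightarrow> (K has_real_derivative k s) (at s)"
    and ge: "\<And>s. s \<ge> a \<Longrightarrow> f' s \<ge> c * k s"
    and "c > 0" and lim: "filterlim K at_top at_top"
  shows "filterlim f at_top at_top"
proof -
  have "f s \<ge> (f a - c * K a) + c * K s" if "s \<ge> a" for s
  proof -
    have "f a - c * K a \<le> f s - c * K s"
    proof (rule DERIV_nonneg_imp_nondecreasing[OF that], intro exI conjI)
      fix x assume "a \<le> x" "x \<le> s"
      then show "((\<lambda>s. f s - c * K s) has_real_derivative f' x - c * k x) (at x)"
        by (auto intro!: derivative_eq_intros f K)
      show "0 \<le> f' x - c * k x" using ge \<open>a \<le> x\<close> by simp
    qed
    then show ?thesis by simp
  qed
  then have "eventually (\<lambda>s. (f a - c * K a) + c * K s \<le> f s) at_top"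
    unfolding eventually_at_top_linorder by blast
  moreover have "filterlim (\<lambda>s. (f a - c * K a) + c * K s) at_top at_top"
    by (intro filterlim_tendsto_add_at_top[OF tendsto_const]
        filterlim_tendsto_pos_mult_at_top[OF tendsto_const] \<open>c > 0\<close> lim)
  ultimately show ?thesis
    by (rule filterlim_at_top_mono[rotated])
qed

text \<open>
  Blow-up in finite time, with the time measured by \<open>K\<close>. The inequality with \<open>\<delta>\<close> drives \<open>z\<close> to
  infinity; once \<open>z \<ge> 1\<close>, the inequality with \<open>\<epsilon>\<close> makes \<open>- z\<^bsup>1-q\<^esup>\<close> increase at least as fast
  as a multiple of \<open>K\<close>, although it stays negative. So \<open>K\<close> cannot be unbounded.
\<close>

lemma superlinear_growth_not_global:
  fixes z z' K k :: "real \<Rightarrow> real"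
  assumes z: "\<And>s. s \<ge> a \<Longrightarrow> (z has_real_derivative z' s) (at s)"
    and K: "\<And>s. s \<ge> a \<Longrightarrow> (K has_real_derivative k s) (at s)"
    and lim: "filterlim K at_top at_top"
    and ge: "\<And>s. s \<ge> a \<Longrightarrow> z' s \<ge> \<delta> * k s"
    and ge_powr: "\<And>s. s \<ge> a \<Longrightarrow> z' s \<ge> \<epsilon> * k s * \<bar>z s\<bar> powr q"
    and "\<delta> > 0" "\<epsilon> > 0" "q > 1"
  shows False
proof -
  have "filterlim z at_top at_top"
    by (rule filterlim_at_top_of_deriv_ge[OF z K ge \<open>\<delta> > 0\<close> lim])
  then have "eventually (\<lambda>s. z s \<ge> 1 \<and> s \<ge> a) at_top"
    by (intro eventually_conj eventually_ge_at_top) (simp add: filterlim_at_top)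
  then obtain b where b: "\<And>s. s \<ge> b \<Longrightarrow> z s \<ge> 1 \<and> s \<ge> a"
    unfolding eventually_at_top_linorder by blast
  have "filterlim (\<lambda>s. - (z s powr (1 - q))) at_top at_top"
  proof (rule filterlim_at_top_of_deriv_ge[where a = b, OF _ K _ _ lim])
    fix s assume "s \<ge> b"
    note s = b[OF this]
    show "((\<lambda>s. - (z s powr (1 - q))) has_real_derivative
        (q - 1) * z s powr (- q) * z' s) (at s)"
      using s by (auto intro!: derivative_eq_intros z simp: algebra_simps)
    have "(q - 1) * \<epsilon> * k s = (q - 1) * z s powr (- q) * (\<epsilon> * k s * \<bar>z s\<bar> powr q)"
      using s by (simp add: powr_minus field_simps)
    also have "\<dots> \<le> (q - 1) * z s powr (- q) * z' s"
      using s \<open>q > 1\<close> by (intro mult_left_mono ge_powr) auto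
    finally show "(q - 1) * \<epsilon> * k s \<le> (q - 1) * z s powr (- q) * z' s" .
  qed (use assms b in auto)
  then have "eventually (\<lambda>s. - (z s powr (1 - q)) \<ge> 1) at_top"
    unfolding filterlim_at_top by blast
  then obtain s where "- (z s powr (1 - q)) \<ge> 1"
    by (auto simp: eventually_at_top_linorder)
  moreover have "z s powr (1 - q) \<ge> 0" by simp
  ultimately show False by linarith
qed

section \<open>Interval integrals\<close>

lemma interval_lebesgue_integrable_iff_Icc:
  fixes a b :: real and f :: "real \<Rightarrow> real"
  shows "interval_lebesgue_integrable lborel (ereal a) (ereal b) f \<longleftrightarrow>
    set_integrable lborel {min a b..max a b} f"
proof -
  have "set_integrable lborel {a<..<b} f \<longleftrightarrow> set_integrable lborel {a..b} f" for a b
    unfolding set_integrable_def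
    by (rule integrable_discrete_difference[where X = "{a, b}"])
      (auto simp: indicator_def)
  then show ?thesis
    by (auto simp: interval_lebesgue_integrable_def min_def max_def)
qed

lemma set_borel_integrable_iff_absolutely_integrable:
  fixes f :: "real \<Rightarrow> real"
  assumes [measurable]: "f \<in> borel_measurable borel" "S \<in> sets borel"
  shows "set_integrable lborel S f \<longleftrightarrow> f absolutely_integrable_on S"
  unfolding set_integrable_def by (rule integrable_completion[symmetric]) simp

text \<open>
  An indefinite integral of a function that is positive off a single point is injective on the set
  where it is defined. This makes the value given by the quadrature unique. The integrability
  assumptions combine to integrability on the hull of \<open>{a, y, z}\<close>, so that the integral over the
  segment from \<open>y\<close> to \<open>z\<close> is \<open>0\<close>, and the integrand vanishes almost everywhere there.
\<close>

lemma interval_integral_inject: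
  fixes f :: "real \<Rightarrow> real"
  assumes nonneg: "\<And>t. f t \<ge> 0" and pos: "\<And>t. t \<noteq> c \<Longrightarrow> f t \<noteq> 0"
    and y: "interval_lebesgue_integrable lborel (ereal a) (ereal y) f"
    and z: "interval_lebesgue_integrable lborel (ereal a) (ereal z) f"
    and eq: "(LBINT t=ereal a..ereal y. f t) = (LBINT t=ereal a..ereal z. f t)"
  shows "y = z"
proof (rule ccontr)
  assume "y \<noteq> z"
  define m M where "m = min a (min y z)" and "M = max a (max y z)"
  have "set_integrable lborel ({min a y..max a y} \<union> {min a z..max a z}) f"
    using y z by (intro set_integrable_Un) (auto simp: interval_lebesgue_integrable_iff_Icc)
  then have hull: "set_integrable lborel {m..M} f"
    by (rule set_integrable_subset) (auto simp: m_def M_def)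
  have "interval_lebesgue_integrable lborel (min (ereal y) (min (ereal a) (ereal z)))
      (max (ereal y) (max (ereal a) (ereal z))) f"
    using hull unfolding ereal_min[symmetric] ereal_max[symmetric]
    by (subst interval_lebesgue_integrable_iff_Icc) (simp add: m_def M_def min.left_commute max.left_commute)
  from interval_integral_sum[OF this]
  have "(LBINT t=ereal y..ereal z. f t) = 0"
    using eq interval_integral_endpoints_reverse[of "ereal y" "ereal a" f] by simp
  then have "(LBINT t=ereal (min y z)..ereal (max y z). f t) = 0"
    using interval_integral_endpoints_reverse[of "ereal y" "ereal z" f]
    by (auto simp: min_def max_def)
  then have zero: "(LBINT t:{min y z..max y z}. f t) = 0"
    by (subst (asm) interval_integral_Icc) auto
  have "set_integrable lborel {min y z..max y z} f"
    using hull by (rule set_integrable_subset) (auto simp: m_def M_def)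
  then have "AE t in lborel. indicator {min y z..max y z} t *\<^sub>R f t = 0"
    using zero unfolding set_integrable_def set_lebesgue_integral_def
    by (subst (asm) integral_nonneg_eq_0_iff_AE) (auto simp: nonneg)
  moreover have "AE t in lborel. t \<noteq> c" by (rule AE_lborel_singleton)
  ultimately have "AE t in lborel. t \<notin> {min y z..max y z}"
    by eventually_elim (auto dest: pos simp: indicator_def split: if_splits)
  then have "emeasure lborel {min y z..max y z} = 0"
    using AE_iff_measurable[of "{min y z..max y z}" lborel "\<lambda>t. t \<notin> {min y z..max y z}"]
    by (simp del: atLeastAtMost_iff)
  then show False
    using \<open>y \<noteq> z\<close> by (auto simp: emeasure_lborel_Icc_eq min_def max_def split: if_splits)
qed

section \<open>The system of the fluxes\<close>

lemma deriv_zero_of_constant: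
  assumes "open S" "x \<in> S" "\<And>t. t \<in> S \<Longrightarrow> f t = c" and "(f has_real_derivative d) (at x)"
  shows "d = 0"
proof -
  have "(f has_real_derivative 0) (at x)"
    using has_field_derivative_transform_within_open[OF DERIV_const[of c] assms(1,2)] assms(3) by simp
  then show ?thesis using assms(4) DERIV_unique by blast
qed

text \<open>
  The system satisfied by the fluxes \<open>w\<^sub>i = r\<^bsup>N-1\<^esup> u\<^sub>i'\<close>. The positive
  weight \<open>k\<close> is a parameter because it can be absorbed into the independent variable; its growth
  decides only how much of that new variable the two ends of the interval provide.
\<close>

locale flux_system =
  fixes q :: real and I :: "real set" and k w1 w2 :: "real \<Rightarrow> real"
  assumes q: "q > 1"
    and I: "open I" "is_interval I"
    and k: "continuous_on I k" "\<And>r. r \<in> I \<Longrightarrow> k r > 0"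
    and w1: "\<And>r. r \<in> I \<Longrightarrow> (w1 has_real_derivative - (k r * \<bar>w2 r\<bar> powr q)) (at r)"
    and w2: "\<And>r. r \<in> I \<Longrightarrow> (w2 has_real_derivative - (k r * \<bar>w1 r\<bar> powr q)) (at r)"
begin

lemma Icc_subset:
  assumes "a \<in> I" "b \<in> I"
  shows "{a..b} \<subseteq> I"
proof
  fix x assume "x \<in> {a..b}"
  then show "x \<in> I" using mem_is_interval_1_I[OF I(2) assms] by simp
qed

lemma segment_subset:
  assumes "a \<in> I" "b \<in> I"
  shows "closed_segment a b \<subseteq> I"
  using I(2) assms by (simp add: closed_segment_subset is_interval_convex)

lemma continuous_w: "continuous_on I w1" "continuous_on I w2"
  by (rule continuous_at_imp_continuous_on; blast intro: DERIV_isCont w1 w2)+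

text \<open>
  Both signed powers have the derivative \<open>- (q + 1) k |w\<^sub>1|\<^sup>q |w\<^sub>2|\<^sup>q\<close>.
\<close>

lemma first_integral:
  obtains C where "\<And>r. r \<in> I \<Longrightarrow> \<bar>w1 r\<bar> powr q * w1 r - \<bar>w2 r\<bar> powr q * w2 r = C"
proof -
  have "((\<lambda>r. \<bar>w1 r\<bar> powr q * w1 r - \<bar>w2 r\<bar> powr q * w2 r) has_real_derivative 0) (at r within I)"
    if "r \<in> I" for r
  proof -
    have "((\<lambda>r. \<bar>w1 r\<bar> powr q * w1 r) has_real_derivative
        (q + 1) * \<bar>w1 r\<bar> powr q * (- (k r * \<bar>w2 r\<bar> powr q))) (at r)"
      using DERIV_chain2[OF has_real_derivative_odd_powr w1[OF that]] q by simp
    moreover have "((\<lambda>r. \<bar>w2 r\<bar> powr q * w2 r) has_real_derivative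
        (q + 1) * \<bar>w2 r\<bar> powr q * (- (k r * \<bar>w1 r\<bar> powr q))) (at r)"
      using DERIV_chain2[OF has_real_derivative_odd_powr w2[OF that]] q by simp
    ultimately have "((\<lambda>r. \<bar>w1 r\<bar> powr q * w1 r - \<bar>w2 r\<bar> powr q * w2 r) has_real_derivative 0) (at r)"
      by (rule DERIV_cong[OF DERIV_diff]) (simp add: algebra_simps)
    then show ?thesis by (rule has_field_derivative_at_within)
  qed
  then obtain C where "\<forall>r\<in>I. \<bar>w1 r\<bar> powr q * w1 r - \<bar>w2 r\<bar> powr q * w2 r = C"
    using has_field_derivative_zero_constant[OF is_interval_convex[OF I(2)]] by blast
  then show thesis using that by blast
qed

text \<open>
  At a common zero the constant of the first integral is \<open>0\<close>, hence \<open>w\<^sub>1 = w\<^sub>2\<close> everywhere, and the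
  system becomes the scalar equation \<open>w' = - k |w|\<^bsup>q-1\<^esup> |w|\<close>, whose coefficient
  \<open>k |w|\<^bsup>q-1\<^esup>\<close> is bounded on compact segments because \<open>q > 1\<close>.
\<close>

lemma vanish_of_common_zero:
  assumes "m \<in> I" "w1 m = 0" "w2 m = 0" "r \<in> I"
  shows "w1 r = 0"
proof -
  obtain C where C: "\<And>r. r \<in> I \<Longrightarrow> \<bar>w1 r\<bar> powr q * w1 r - \<bar>w2 r\<bar> powr q * w2 r = C"
    using first_integral by blast
  have eq: "w1 s = w2 s" if "s \<in> I" for s
    using C[OF that] C[OF \<open>m \<in> I\<close>] assms q odd_powr_eq_iff[of q "w1 s" "w2 s"] by simp
  have "continuous_on (closed_segment m r) (\<lambda>s. k s * \<bar>w1 s\<bar> powr (q - 1))"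
    using segment_subset[OF assms(1,4)] q
    by (intro continuous_on_mult continuous_on_powr' continuous_on_rabs continuous_on_const
        continuous_on_subset[OF k(1)] continuous_on_subset[OF continuous_w(1)]) auto
  then have "bounded ((\<lambda>s. k s * \<bar>w1 s\<bar> powr (q - 1)) ` closed_segment m r)"
    by (intro compact_imp_bounded compact_continuous_image) auto
  then obtain M where "\<forall>s\<in>closed_segment m r. \<bar>k s * \<bar>w1 s\<bar> powr (q - 1)\<bar> \<le> M"
    unfolding bounded_iff by (auto simp del: abs_mult)
  then have M: "k s * \<bar>w1 s\<bar> powr (q - 1) \<le> M" if "s \<in> closed_segment m r" for s
    using that abs_le_D1 by blast
  show "w1 r = 0"
  proof (rule zero_of_linear_growth[where f = w1 and a = m and b = r and M = M
        and f' = "\<lambda>s. - (k s * \<bar>w2 s\<bar> powr q)"])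
    fix s assume s: "s \<in> closed_segment m r"
    then have sI: "s \<in> I" using segment_subset[OF assms(1,4)] by blast
    show "(w1 has_real_derivative - (k s * \<bar>w2 s\<bar> powr q)) (at s)" by (rule w1[OF sI])
    have "\<bar>w2 s\<bar> powr q = \<bar>w1 s\<bar> powr (q - 1) * \<bar>w1 s\<bar>"
      using eq[OF sI] by (cases "w1 s = 0") (auto simp: powr_diff)
    then have "\<bar>- (k s * \<bar>w2 s\<bar> powr q)\<bar> = k s * \<bar>w1 s\<bar> powr (q - 1) * \<bar>w1 s\<bar>"
      using k(2)[OF sI] by (simp add: abs_mult)
    also have "\<dots> \<le> M * \<bar>w1 s\<bar>" by (intro mult_right_mono M s) auto
    finally show "\<bar>- (k s * \<bar>w2 s\<bar> powr q)\<bar> \<le> M * \<bar>w1 s\<bar>" .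
  qed fact
qed

lemma antimono:
  assumes "a \<in> I" "b \<in> I" "a \<le> b"
  shows "w1 b \<le> w1 a" "w2 b \<le> w2 a"
proof -
  have I': "x \<in> I" if "a \<le> x" "x \<le> b" for x
    using Icc_subset[OF assms(1,2)] that by auto
  have nonpos: "- (k x * \<bar>w\<bar> powr q) \<le> 0" if "x \<in> I" for x w
    using k(2)[OF that] by simp
  show "w1 b \<le> w1 a"
    by (rule DERIV_nonpos_imp_nonincreasing[OF assms(3)]) (meson I' w1 nonpos)
  show "w2 b \<le> w2 a"
    by (rule DERIV_nonpos_imp_nonincreasing[OF assms(3)]) (meson I' w2 nonpos)
qed

text \<open>
  For \<open>C \<noteq> 0\<close> the equation obtained by eliminating \<open>w\<^sub>2\<close> is not Lipschitz where \<open>w\<^sub>2 = 0\<close>, and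
  taken alone it admits a constant solution there. The system excludes it: between two zeros the
  monotone function \<open>w\<^sub>2\<close> would vanish, so its derivative \<open>- k |w\<^sub>1|\<^sup>q\<close> would vanish too, and this gives a
  common zero.
\<close>

lemma zero_of_w2_unique:
  assumes nontriv: "\<not> (\<exists>r\<in>I. w1 r = 0 \<and> w2 r = 0)"
    and ab: "a \<in> I" "b \<in> I" "w2 a = 0" "w2 b = 0"
  shows "a = b"
proof -
  have False if "a < b" "a \<in> I" "b \<in> I" "w2 a = 0" "w2 b = 0" for a b
  proof -
    have sub: "{a..b} \<subseteq> I" by (rule Icc_subset[OF that(2,3)])
    have zero: "w2 t = 0" if "t \<in> {a<..<b}" for t
    proof (rule antisym)
      have t: "t \<in> I" "a \<le> t" "t \<le> b" using that sub by auto
      show "w2 t \<le> 0" using antimono(2)[OF \<open>a \<in> I\<close> t(1,2)] \<open>w2 a = 0\<close> by simp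
      show "0 \<le> w2 t" using antimono(2)[OF t(1) \<open>b \<in> I\<close> t(3)] \<open>w2 b = 0\<close> by simp
    qed
    obtain m where m: "m \<in> {a<..<b}" using \<open>a < b\<close> dense by auto
    have mI: "m \<in> I" using m sub by auto
    have "- (k m * \<bar>w1 m\<bar> powr q) = 0"
      by (rule deriv_zero_of_constant[OF _ m zero w2[OF mI]]) auto
    then have "w1 m = 0" using k(2)[OF mI] by simp
    then show False using nontriv mI zero[OF m] by blast
  qed
  from this[of a b] this[of b a] show ?thesis using ab by fastforce
qed

text \<open>
  On an interval where \<open>w\<^sub>1\<close> is constant, its derivative \<open>- k |w\<^sub>2|\<^sup>q\<close> vanishes, but \<open>w\<^sub>2\<close> has at most one zero
  if the solution is not trivial.
\<close>

lemma strict_antimono_w1: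
  assumes nontriv: "\<not> (\<exists>r\<in>I. w1 r = 0 \<and> w2 r = 0)"
    and ab: "a \<in> I" "b \<in> I" "a < b"
  shows "w1 b < w1 a"
proof (rule ccontr)
  assume "\<not> w1 b < w1 a"
  have sub: "{a..b} \<subseteq> I" by (rule Icc_subset[OF ab(1,2)])
  have const: "w1 t = w1 a" if "t \<in> {a<..<b}" for t
  proof (rule antisym)
    have t: "t \<in> I" "a \<le> t" "t \<le> b" using that sub by auto
    show "w1 t \<le> w1 a" by (rule antimono(1)[OF ab(1) t(1,2)])
    show "w1 a \<le> w1 t" using antimono(1)[OF t(1) ab(2) t(3)] \<open>\<not> w1 b < w1 a\<close> by simp
  qed
  have zero: "w2 m = 0" if m: "m \<in> {a<..<b}" for m
  proof -
    have mI: "m \<in> I" using m sub by auto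
    have "- (k m * \<bar>w2 m\<bar> powr q) = 0"
      by (rule deriv_zero_of_constant[OF _ m const w1[OF mI]]) auto
    then show ?thesis using k(2)[OF mI] by simp
  qed
  obtain m where m: "a < m" "m < b" using \<open>a < b\<close> dense by auto
  obtain n where n: "a < n" "n < m" using \<open>a < m\<close> dense by auto
  have "n = m"
    by (rule zero_of_w2_unique[OF nontriv]) (use m n sub zero in auto)
  then show False using n by simp
qed

text \<open>
  Change of variables \<open>t = w\<^sub>1(s)\<close>. By the first integral \<open>f (w\<^sub>1(s)) = |w\<^sub>2(s)|\<^bsup>-q\<^esup>\<close>, which cancels
  the factor \<open>|w\<^sub>2|\<^sup>q\<close> in \<open>|w\<^sub>1'|\<close> and leaves \<open>k\<close>. The only possible exception is the zero of
  \<open>w\<^sub>2\<close>, one point at most, so the singularity of \<open>f\<close> needs no separate estimate: its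
  integrability is a consequence of the continuity of \<open>k\<close>.
\<close>

lemma quadrature_ordered:
  assumes nontriv: "\<not> (\<exists>r\<in>I. w1 r = 0 \<and> w2 r = 0)"
    and C: "\<And>r. r \<in> I \<Longrightarrow> \<bar>w1 r\<bar> powr q * w1 r - \<bar>w2 r\<bar> powr q * w2 r = C"
    and ab: "a \<in> I" "b \<in> I" "a \<le> b"
  defines "f \<equiv> \<lambda>t. \<bar>\<bar>t\<bar> powr q * t - C\<bar> powr (- (q / (q + 1)))"
  shows "interval_lebesgue_integrable lborel (ereal (w1 b)) (ereal (w1 a)) f"
    and "(LBINT t=ereal (w1 b)..ereal (w1 a). f t) = (LBINT s=ereal a..ereal b. k s)"
proof -
  have sub: "{a..b} \<subseteq> I" by (rule Icc_subset[OF ab(1,2)])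
  have le: "w1 b \<le> w1 a" by (rule antimono(1)[OF ab])
  have meas: "f \<in> borel_measurable borel" unfolding f_def by measurable
  have k_cont: "continuous_on {a..b} k" by (rule continuous_on_subset[OF k(1) sub])
  have inj: "inj_on w1 {a..b}"
  proof (rule inj_onI)
    fix x y assume xy: "x \<in> {a..b}" "y \<in> {a..b}" and "w1 x = w1 y"
    have "x \<in> I" "y \<in> I" using xy sub by blast+
    then have "\<not> x < y" "\<not> y < x"
      using \<open>w1 x = w1 y\<close> strict_antimono_w1[OF nontriv, of x y] strict_antimono_w1[OF nontriv, of y x]
      by fastforce+
    then show "x = y" by simp
  qed
  have der: "(w1 has_real_derivative - (k s * \<bar>w2 s\<bar> powr q)) (at s within {a..b})"
    if "s \<in> {a..b}" for s
    using w1 that sub by (blast intro: has_field_derivative_at_within)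
  have image: "w1 ` {a..b} = {w1 b..w1 a}"
  proof
    show "w1 ` {a..b} \<subseteq> {w1 b..w1 a}"
    proof (rule image_subsetI)
      fix x assume "x \<in> {a..b}"
      then have "x \<in> I" "a \<le> x" "x \<le> b" using sub by auto
      then show "w1 x \<in> {w1 b..w1 a}" using antimono(1) ab by simp
    qed
    show "{w1 b..w1 a} \<subseteq> w1 ` {a..b}"
    proof
      fix y assume "y \<in> {w1 b..w1 a}"
      then obtain x where "a \<le> x" "x \<le> b" "w1 x = y"
        using IVT2'[of w1 b y a] ab(3) continuous_on_subset[OF continuous_w(1) sub] by auto
      then show "y \<in> w1 ` {a..b}" by auto
    qed
  qed
  have negl: "negligible {s \<in> {a..b}. w2 s = 0}"
  proof (cases "{s \<in> {a..b}. w2 s = 0} = {}")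
    case False
    then obtain s where s: "s \<in> {a..b}" "w2 s = 0" by blast
    have "t = s" if "t \<in> {a..b}" "w2 t = 0" for t
      by (rule zero_of_w2_unique[OF nontriv]) (use that s sub in blast)+
    then have "{s \<in> {a..b}. w2 s = 0} \<subseteq> {s}" by blast
    then show ?thesis by (rule negligible_subset[OF negligible_sing])
  next
    case True
    then show ?thesis by (metis negligible_empty)
  qed
  have integrand: "\<bar>- (k s * \<bar>w2 s\<bar> powr q)\<bar> * f (w1 s) = k s"
    if "s \<in> {a..b} - {s \<in> {a..b}. w2 s = 0}" for s
  proof -
    have s: "s \<in> I" "w2 s \<noteq> 0" using that sub by auto
    have "\<bar>w1 s\<bar> powr q * w1 s - C = \<bar>w2 s\<bar> powr q * w2 s" using C[OF s(1)] by simp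
    then have "f (w1 s) = (\<bar>w2 s\<bar> powr (q + 1)) powr (- (q / (q + 1)))"
      by (simp only: f_def abs_odd_powr)
    also have "\<dots> = \<bar>w2 s\<bar> powr (- q)" using q by (simp add: powr_powr)
    finally show ?thesis using k(2)[OF s(1)] s(2) by (simp add: abs_mult powr_minus)
  qed
  have "(\<lambda>s. \<bar>- (k s * \<bar>w2 s\<bar> powr q)\<bar> * f (w1 s)) absolutely_integrable_on {a..b}"
    by (rule absolutely_integrable_spike[OF absolutely_integrable_continuous_real[OF k_cont] negl integrand])
  moreover have "integral {a..b} (\<lambda>s. \<bar>- (k s * \<bar>w2 s\<bar> powr q)\<bar> * f (w1 s)) = integral {a..b} k"
    by (rule integral_spike[OF negl]) (use integrand in auto)
  moreover have "{a..b} \<in> sets lebesgue" by simp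
  ultimately have "f absolutely_integrable_on w1 ` {a..b} \<and> integral (w1 ` {a..b}) f = integral {a..b} k"
    using has_absolute_integral_change_of_variables_1'[of "{a..b}" w1
        "\<lambda>s. - (k s * \<bar>w2 s\<bar> powr q)" f "integral {a..b} k", OF _ der inj] by blast
  then have f: "set_integrable lborel {w1 b..w1 a} f" "integral {w1 b..w1 a} f = integral {a..b} k"
    using set_borel_integrable_iff_absolutely_integrable[OF meas, of "{w1 b..w1 a}"]
    by (auto simp: image)
  show "interval_lebesgue_integrable lborel (ereal (w1 b)) (ereal (w1 a)) f"
    using f(1) le by (simp add: interval_lebesgue_integrable_iff_Icc)
  show "(LBINT t=ereal (w1 b)..ereal (w1 a). f t) = (LBINT s=ereal a..ereal b. k s)"
    using interval_integral_eq_integral[OF le f(1)] f(2)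
      interval_integral_eq_integral[OF ab(3) borel_integrable_atLeastAtMost'[OF k_cont]] by simp
qed

lemma quadrature:
  assumes nontriv: "\<not> (\<exists>r\<in>I. w1 r = 0 \<and> w2 r = 0)"
    and C: "\<And>r. r \<in> I \<Longrightarrow> \<bar>w1 r\<bar> powr q * w1 r - \<bar>w2 r\<bar> powr q * w2 r = C"
    and ab: "a \<in> I" "b \<in> I"
  shows "interval_lebesgue_integrable lborel (ereal (w1 a)) (ereal y)
           (\<lambda>t. \<bar>\<bar>t\<bar> powr q * t - C\<bar> powr (- (q / (q + 1)))) \<and>
         (LBINT t=ereal (w1 a)..ereal y. \<bar>\<bar>t\<bar> powr q * t - C\<bar> powr (- (q / (q + 1)))) =
           - (LBINT s=ereal a..ereal b. k s) \<longleftrightarrow> y = w1 b"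
    (is "?P y \<longleftrightarrow> _")
proof -
  have P: "?P (w1 b)"
  proof (cases "a \<le> b")
    case True
    then show ?thesis
      using quadrature_ordered[OF nontriv C ab]
      by (subst interval_integrable_endpoints_reverse, subst interval_integral_endpoints_reverse) simp
  next
    case False
    then have "b \<le> a" by simp
    then show ?thesis
      using quadrature_ordered[OF nontriv C ab(2,1)]
        interval_integral_endpoints_reverse[of "ereal a" "ereal b" k] by simp
  qed
  have pos: "\<bar>\<bar>t\<bar> powr q * t - C\<bar> powr (- (q / (q + 1))) \<noteq> 0" if "t \<noteq> signed_root (q + 1) C" for t
    using that signed_root_odd_powr[of q t] q by auto
  show ?thesis
  proof
    assume y: "?P y"
    show "y = w1 b"
    proof (rule interval_integral_inject[OF powr_ge_zero pos])
      show "(LBINT t=ereal (w1 a)..ereal y. \<bar>\<bar>t\<bar> powr q * t - C\<bar> powr (- (q / (q + 1)))) =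
          (LBINT t=ereal (w1 a)..ereal (w1 b). \<bar>\<bar>t\<bar> powr q * t - C\<bar> powr (- (q / (q + 1))))"
        using y P by (metis (no_types))
    qed (use y P in blast)+
  next
    assume "y = w1 b"
    then show "?P y" using P by blast
  qed
qed

text \<open>
  If the fluxes have a common zero, they vanish identically and \<open>C = A = 0\<close>: this is the exceptional
  clause of the quadrature relation. Conversely \<open>C = A = 0\<close> forces a common zero at \<open>a\<close>.
\<close>

lemma flux_quadrature_iff:
  assumes k_eq: "k = (\<lambda>s. s powr ((real N - 1) * (1 - q)))"
    and C: "\<And>r. r \<in> I \<Longrightarrow> \<bar>w1 r\<bar> powr q * w1 r - \<bar>w2 r\<bar> powr q * w2 r = C"
    and ab: "a \<in> I" "b \<in> I"
  shows "flux_quadrature N q C a (w1 a) b y \<longleftrightarrow> y = w1 b"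
proof (cases "\<exists>r\<in>I. w1 r = 0 \<and> w2 r = 0")
  case True
  then have "w1 r = 0" if "r \<in> I" for r
    using vanish_of_common_zero that by blast
  moreover from True have "C = 0" using C by fastforce
  ultimately show ?thesis using ab by (simp add: flux_quadrature_def)
next
  case False
  have "\<not> (C = 0 \<and> w1 a = 0)"
  proof
    assume "C = 0 \<and> w1 a = 0"
    then have "\<bar>w2 a\<bar> powr q * w2 a = 0" using C[OF ab(1)] by simp
    then have "w2 a = 0" by auto
    then show False using False ab(1) \<open>C = 0 \<and> w1 a = 0\<close> by blast
  qed
  then have "flux_quadrature N q C a (w1 a) b y \<longleftrightarrow>
      interval_lebesgue_integrable lborel (ereal (w1 a)) (ereal y)
        (\<lambda>t. \<bar>\<bar>t\<bar> powr q * t - C\<bar> powr (- (q / (q + 1)))) \<and>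
      (LBINT t=ereal (w1 a)..ereal y. \<bar>\<bar>t\<bar> powr q * t - C\<bar> powr (- (q / (q + 1)))) =
        - (LBINT s=ereal a..ereal b. k s)"
    unfolding flux_quadrature_def k_eq by (simp only: if_False)
  also have "\<dots> \<longleftrightarrow> y = w1 b"
    by (rule quadrature[OF False C ab])
  finally show ?thesis .
qed

text \<open>
  Let \<open>C \<noteq> 0\<close>. The sum \<open>z = w\<^sub>1 + w\<^sub>2\<close> satisfies \<open>- z' \<ge> \<delta> k\<close> and \<open>- z' \<ge> \<epsilon> k |z|\<^sup>q\<close> on the whole
  half-line, so it must blow up in any direction in which the integral of \<open>k = r\<^bsup>\<beta>\<^esup>\<close> is infinite.
  There always is one: infinity if \<open>\<beta> \<ge> - 1\<close>, and the origin if \<open>\<beta> < - 1\<close>.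
\<close>

lemma constant_zero_of_global:
  assumes I_eq: "I = {0<..}" and k_eq: "k = (\<lambda>r. r powr \<beta>)"
    and C: "\<And>r. r \<in> I \<Longrightarrow> \<bar>w1 r\<bar> powr q * w1 r - \<bar>w2 r\<bar> powr q * w2 r = C"
  shows "C = 0"
proof (rule ccontr)
  assume "C \<noteq> 0"
  define \<delta> where "\<delta> = (\<bar>C\<bar> / 2) powr (q / (q + 1))"
  define \<epsilon> where "\<epsilon> = (1 / 2 :: real) powr q"
  have pos: "\<delta> > 0" "\<epsilon> > 0" using \<open>C \<noteq> 0\<close> by (auto simp: \<delta>_def \<epsilon>_def)
  define z where "z = (\<lambda>r. w1 r + w2 r)"
  define z' where "z' = (\<lambda>r. - (k r * (\<bar>w1 r\<bar> powr q + \<bar>w2 r\<bar> powr q)))"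
  have z: "(z has_real_derivative z' r) (at r)" if "r > 0" for r
    unfolding z_def z'_def
    by (rule DERIV_cong[OF DERIV_add[OF w1 w2]]) (use that I_eq in \<open>auto simp: algebra_simps\<close>)
  have z'_le: "\<delta> * k r \<le> - z' r" "\<epsilon> * k r * \<bar>z r\<bar> powr q \<le> - z' r" if "r > 0" for r
  proof -
    have r: "k r > 0" "\<bar>w1 r\<bar> powr q * w1 r - \<bar>w2 r\<bar> powr q * w2 r = C"
      using that k(2) C by (auto simp: I_eq)
    show "\<delta> * k r \<le> - z' r"
      using mult_left_mono[OF sum_powr_ge_const[OF r(2)], of "k r"] q r(1)
      by (simp add: \<delta>_def z'_def mult.commute)
    show "\<epsilon> * k r * \<bar>z r\<bar> powr q \<le> - z' r"
      using mult_left_mono[OF sum_powr_ge_powr_sum[of q "w1 r" "w2 r"], of "k r"] q r(1)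
      by (simp add: \<epsilon>_def z_def z'_def mult.left_commute mult.commute)
  qed
  have antideriv: "((\<lambda>s. s powr (\<beta> + 1) / (\<beta> + 1)) has_real_derivative k s) (at s)"
    if "s > 0" "\<beta> \<noteq> - 1" for s
  proof -
    have "\<beta> + 1 \<noteq> 0" using that(2) by linarith
    then show ?thesis
      using DERIV_cdivide[OF has_real_derivative_powr[OF that(1), of "\<beta> + 1"], of "\<beta> + 1"]
      by (simp add: k_eq)
  qed
  show False
  proof (cases "\<beta> \<ge> - 1")
    case True
    define K where "K = (\<lambda>s::real. if \<beta> = - 1 then ln s else s powr (\<beta> + 1) / (\<beta> + 1))"
    show False
    proof (rule superlinear_growth_not_global[where a = 1 and z = "\<lambda>s. - z s" and K = K and k = k
          and \<delta> = \<delta> and \<epsilon> = \<epsilon> and q = q])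
      show "((\<lambda>s. - z s) has_real_derivative - z' s) (at s)" if "s \<ge> 1" for s
        using that by (auto intro!: derivative_eq_intros z)
      show "(K has_real_derivative k s) (at s)" if "s \<ge> 1" for s
      proof (cases "\<beta> = - 1")
        case True
        then show ?thesis
          using that DERIV_ln_divide[of s] by (simp add: K_def k_eq powr_minus_divide)
      next
        case False
        then show ?thesis using that antideriv[of s] by (simp add: K_def)
      qed
      show "filterlim K at_top at_top"
      proof (cases "\<beta> = - 1")
        case True
        then show ?thesis using ln_at_top by (simp add: K_def)
      next
        case False
        then have "\<beta> + 1 > 0" using \<open>\<beta> \<ge> - 1\<close> by linarith
        then have "filterlim (\<lambda>s. s powr (\<beta> + 1) / (\<beta> + 1)) at_top at_top" by real_asymp
        then show ?thesis using False by (simp add: K_def)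
      qed
    qed (use z'_le pos q in auto)
  next
    case False
    define K where "K = (\<lambda>s::real. - ((1 / s) powr (\<beta> + 1) / (\<beta> + 1)))"
    \<comment> \<open>Near the origin the variable is \<open>s = 1 / r\<close>, which reverses the orientation, so here \<open>z\<close> itself increases.\<close>
    have recip: "((\<lambda>s. 1 / s) has_real_derivative - 1 / s\<^sup>2) (at s)" if "s \<ge> 1" for s :: real
      using that by (auto intro!: derivative_eq_intros simp: power2_eq_square)
    show False
    proof (rule superlinear_growth_not_global[where a = 1 and z = "\<lambda>s. z (1 / s)" and K = K
          and k = "\<lambda>s. k (1 / s) / s\<^sup>2" and \<delta> = \<delta> and \<epsilon> = \<epsilon> and q = q])
      show "((\<lambda>s. z (1 / s)) has_real_derivative - z' (1 / s) / s\<^sup>2) (at s)" if "s \<ge> 1" for s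
        using DERIV_chain2[OF z recip[OF that]] that by simp
      show "(K has_real_derivative k (1 / s) / s\<^sup>2) (at s)" if "s \<ge> 1" for s
        unfolding K_def
        using DERIV_minus[OF DERIV_chain2[OF antideriv recip[OF that]]] that False by simp
      show "filterlim K at_top at_top"
      proof -
        have "\<beta> + 1 < 0" using False by linarith
        then show ?thesis unfolding K_def by real_asymp
      qed
      show "\<delta> * (k (1 / s) / s\<^sup>2) \<le> - z' (1 / s) / s\<^sup>2" if "s \<ge> 1" for s
        using divide_right_mono[OF z'_le(1)[of "1 / s"], of "s\<^sup>2"] that by simp
      show "\<epsilon> * (k (1 / s) / s\<^sup>2) * \<bar>z (1 / s)\<bar> powr q \<le> - z' (1 / s) / s\<^sup>2" if "s \<ge> 1" for s
        using divide_right_mono[OF z'_le(2)[of "1 / s"], of "s\<^sup>2"] that by simp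
    qed (use pos q in auto)
  qed
qed

end

section \<open>Radial functions\<close>

text \<open>
  The profile of a radial function and the derivative of the profile are restrictions of the
  function and of one of its partial derivatives to a coordinate ray. So they inherit their
  regularity along that ray.
\<close>

lemma has_real_derivative_ray:
  fixes f :: "'a::euclidean_space \<Rightarrow> real"
  assumes "f differentiable (at (r *\<^sub>R e))"
  shows "((\<lambda>s. f (s *\<^sub>R e)) has_real_derivative pderivative e f (r *\<^sub>R e)) (at r)"
proof -
  let ?D = "frechet_derivative f (at (r *\<^sub>R e))"
  have D: "(f has_derivative ?D) (at (r *\<^sub>R e))"
    using assms frechet_derivative_works by blast
  have "((\<lambda>s. s *\<^sub>R e) has_derivative (\<lambda>h. h *\<^sub>R e)) (at r)"
    by (auto intro!: derivative_eq_intros)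
  from has_derivative_compose[OF this D]
  have "((\<lambda>s. f (s *\<^sub>R e)) has_derivative (\<lambda>h. ?D (h *\<^sub>R e))) (at r)" .
  moreover have "(\<lambda>h. ?D (h *\<^sub>R e)) = (*) (pderivative e f (r *\<^sub>R e))"
    using linear_scale[OF has_derivative_linear[OF D]] by (auto simp: pderivative_def mult.commute)
  ultimately show ?thesis by (simp add: has_field_derivative_def)
qed

locale radial_C2 =
  fixes u :: "'a::euclidean_space \<Rightarrow> real" and v :: "real \<Rightarrow> real" and I :: "real set"
  assumes I: "open I" "I \<subseteq> {0<..}"
    and profile: "radial_profile {x. norm x \<in> I} u v"
    and C2: "C2_on {x. norm x \<in> I} u"
begin

lemma open_shell: "open {x::'a. norm x \<in> I}"
proof -
  have "open (norm -` I :: 'a set)"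
    by (intro open_vimage I(1) continuous_on_norm_id)
  then show ?thesis by (simp add: vimage_def)
qed

lemma profile_eq: "norm x \<in> I \<Longrightarrow> u x = v (norm x)"
  using profile by (simp add: radial_profile_def)

lemma norm_ray: "e \<in> Basis \<Longrightarrow> r \<in> I \<Longrightarrow> norm (r *\<^sub>R e :: 'a) = r"
  using I(2) by auto

lemma has_real_derivative_profile:
  assumes "r \<in> I"
  shows "(v has_real_derivative deriv v r) (at r)"
    and "e \<in> Basis \<Longrightarrow> deriv v r = pderivative e u (r *\<^sub>R e)"
proof -
  have *: "(v has_real_derivative pderivative e u (r *\<^sub>R e)) (at r)" if "e \<in> Basis" for e
  proof -
    have "((\<lambda>s. u (s *\<^sub>R e)) has_real_derivative pderivative e u (r *\<^sub>R e)) (at r)"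
      using C2 norm_ray[OF that assms] assms by (intro has_real_derivative_ray) (auto simp: C2_on_def)
    then show ?thesis
      by (rule has_field_derivative_transform_within_open[OF _ I(1) assms])
        (use norm_ray[OF that] profile_eq in simp)
  qed
  then show "(v has_real_derivative deriv v r) (at r)"
    using nonempty_Basis DERIV_imp_deriv by (metis ex_in_conv)
  show "deriv v r = pderivative e u (r *\<^sub>R e)" if "e \<in> Basis"
    using *[OF that] by (rule DERIV_imp_deriv)
qed

lemma has_real_derivative_deriv_profile:
  assumes "r \<in> I"
  shows "(deriv v has_real_derivative deriv (deriv v) r) (at r)"
proof -
  obtain e :: 'a where e: "e \<in> Basis" using nonempty_Basis by blast
  have "((\<lambda>s. pderivative e u (s *\<^sub>R e)) has_real_derivative
      pderivative e (pderivative e u) (r *\<^sub>R e)) (at r)"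
    using C2 norm_ray[OF e assms] assms e by (intro has_real_derivative_ray) (auto simp: C2_on_def)
  then have "(deriv v has_real_derivative pderivative e (pderivative e u) (r *\<^sub>R e)) (at r)"
    by (rule has_field_derivative_transform_within_open[OF _ I(1) assms])
      (use has_real_derivative_profile(2) e in simp)
  then show ?thesis by (simp add: DERIV_imp_deriv)
qed

lemma pderivative_radial:
  assumes "norm x \<in> I"
  shows "pderivative i u x = deriv v (norm x) / norm x * (x \<bullet> i)"
proof -
  have "x \<noteq> 0" using I(2) assms by auto
  have "(v has_derivative (*) (deriv v (norm x))) (at (norm x))"
    using has_real_derivative_profile(1)[OF assms] by (simp add: has_field_derivative_def)
  from has_derivative_compose[OF has_derivative_norm[OF \<open>x \<noteq> 0\<close>] this]
  have "((\<lambda>y. v (norm y)) has_derivative (\<lambda>h. deriv v (norm x) * (h \<bullet> sgn x))) (at x)"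
    by simp
  then have "(u has_derivative (\<lambda>h. deriv v (norm x) * (h \<bullet> sgn x))) (at x)"
    by (rule has_derivative_transform_within_open[OF _ open_shell]) (use assms profile_eq in auto)
  then have "frechet_derivative u (at x) = (\<lambda>h. deriv v (norm x) * (h \<bullet> sgn x))"
    by (rule frechet_derivative_at[symmetric])
  then show ?thesis
    by (simp add: pderivative_def sgn_div_norm inner_commute divide_inverse)
qed

lemma norm_gradient_radial:
  assumes "norm x \<in> I"
  shows "norm (gradient u x) = \<bar>deriv v (norm x)\<bar>"
proof -
  have "gradient u x = (deriv v (norm x) / norm x) *\<^sub>R (\<Sum>i\<in>Basis. (x \<bullet> i) *\<^sub>R i)"
    by (simp add: gradient_def pderivative_radial[OF assms] scaleR_sum_right)
  moreover have "norm x > 0" using I(2) assms by auto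
  ultimately show ?thesis by (simp add: euclidean_representation)
qed

text \<open>
  With \<open>\<psi>(s) = v'(s) / s\<close> the first partial derivatives are \<open>\<psi>(|x|) x\<^sub>i\<close>, so the second pure ones are
  \<open>\<psi>'(|x|) x\<^sub>i\<^sup>2 / |x| + \<psi>(|x|)\<close>, and summation over \<open>i\<close> gives \<open>r \<psi>'(r) + N \<psi>(r)\<close> at \<open>r = |x|\<close>.
\<close>

lemma laplacian_radial:
  assumes x: "norm x \<in> I"
  shows "laplacian u x =
    deriv (deriv v) (norm x) + (real DIM('a) - 1) / norm x * deriv v (norm x)"
proof -
  define r where "r = norm x"
  define \<psi> where "\<psi> = (\<lambda>s. deriv v s / s)"
  define \<psi>' where "\<psi>' = deriv (deriv v) r / r - deriv v r / r\<^sup>2"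
  have r: "r > 0" "r \<in> I" and "x \<noteq> 0" using I(2) x by (auto simp: r_def)
  have "(\<psi> has_real_derivative \<psi>') (at r)"
    using r(1) unfolding \<psi>_def \<psi>'_def
    by (auto intro!: derivative_eq_intros has_real_derivative_deriv_profile[OF r(2)]
        simp: power2_eq_square field_simps)
  then have "(\<psi> has_derivative (*) \<psi>') (at (norm x))"
    by (simp add: has_field_derivative_def r_def)
  from has_derivative_compose[OF has_derivative_norm[OF \<open>x \<noteq> 0\<close>] this]
  have \<psi>: "((\<lambda>y. \<psi> (norm y)) has_derivative (\<lambda>h. \<psi>' * (h \<bullet> sgn x))) (at x)" by simp
  have second: "pderivative i (pderivative i u) x = \<psi>' * (x \<bullet> i)\<^sup>2 / r + \<psi> r" if "i \<in> Basis" for i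
  proof -
    have "((\<lambda>y. \<psi> (norm y) * (y \<bullet> i)) has_derivative
        (\<lambda>h. \<psi> (norm x) * (h \<bullet> i) + \<psi>' * (h \<bullet> sgn x) * (x \<bullet> i))) (at x)"
      by (intro has_derivative_mult \<psi> derivative_intros)
    then have "(pderivative i u has_derivative
        (\<lambda>h. \<psi> (norm x) * (h \<bullet> i) + \<psi>' * (h \<bullet> sgn x) * (x \<bullet> i))) (at x)"
      by (rule has_derivative_transform_within_open[OF _ open_shell])
        (use x pderivative_radial in \<open>auto simp: \<psi>_def\<close>)
    then have "frechet_derivative (pderivative i u) (at x) =
        (\<lambda>h. \<psi> (norm x) * (h \<bullet> i) + \<psi>' * (h \<bullet> sgn x) * (x \<bullet> i))"
      by (rule frechet_derivative_at[symmetric])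
    then show ?thesis
      using that by (simp add: pderivative_def[of i "pderivative i u"] r_def sgn_div_norm
          inner_commute inner_same_Basis power2_eq_square divide_inverse)
  qed
  have "laplacian u x = (\<Sum>i\<in>Basis. \<psi>' / r * (x \<bullet> i)\<^sup>2 + \<psi> r)"
    unfolding laplacian_def by (intro sum.cong refl) (simp add: second)
  also have "\<dots> = \<psi>' / r * (\<Sum>i\<in>Basis. (x \<bullet> i)\<^sup>2) + real DIM('a) * \<psi> r"
    by (simp add: sum.distrib sum_distrib_left)
  also have "(\<Sum>i\<in>Basis. (x \<bullet> i)\<^sup>2) = r\<^sup>2"
    unfolding r_def power2_norm_eq_inner
    by (subst euclidean_inner[of x x]) (simp add: power2_eq_square)
  also have "\<psi>' / r * r\<^sup>2 + real DIM('a) * \<psi> r =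
      deriv (deriv v) r + (real DIM('a) - 1) / r * deriv v r"
    using r(1) by (simp add: \<psi>_def \<psi>'_def power2_eq_square field_simps)
  finally show ?thesis by (simp add: r_def)
qed

text \<open>
  This is the divergence form \<open>(r\<^bsup>N-1\<^esup> v')' = r\<^bsup>N-1\<^esup> \<Delta>u\<close> of the radial Laplacian, with \<open>\<Delta>u\<close>
  evaluated on the coordinate ray spanned by \<open>e\<close>.
\<close>

lemma has_real_derivative_flux:
  assumes "e \<in> Basis" "r \<in> I"
  shows "((\<lambda>s. s ^ (DIM('a) - 1) * deriv v s) has_real_derivative
    r ^ (DIM('a) - 1) * laplacian u (r *\<^sub>R e)) (at r)"
proof -
  obtain n where n: "DIM('a) = Suc n" using DIM_positive[where 'a = 'a] gr0_conv_Suc by blast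
  have r: "r > 0" using I(2) assms(2) by auto
  have "((\<lambda>s. s ^ n * deriv v s) has_real_derivative
      real n * r ^ (n - 1) * deriv v r + r ^ n * deriv (deriv v) r) (at r)"
    by (auto intro!: derivative_eq_intros has_real_derivative_deriv_profile[OF assms(2)])
  moreover have "real n * r ^ (n - 1) * deriv v r = real n / r * deriv v r * r ^ n"
    using r by (cases n) auto
  moreover have "laplacian u (r *\<^sub>R e) = deriv (deriv v) r + real n / r * deriv v r"
    using laplacian_radial[of "r *\<^sub>R e"] norm_ray[OF assms] assms(2) n by simp
  ultimately show ?thesis
    unfolding n by (auto elim!: DERIV_cong simp: algebra_simps simp del: power_Suc)
qed

end

lemma differential_operators_add_const:
  fixes u f :: "'a::euclidean_space \<Rightarrow> real"
  assumes "open S" "C2_on S u" "\<And>x. x \<in> S \<Longrightarrow> f x = u x + c"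
  shows "C2_on S f"
    and "x \<in> S \<Longrightarrow> gradient f x = gradient u x"
    and "x \<in> S \<Longrightarrow> laplacian f x = laplacian u x"
proof -
  have *: "(g has_derivative frechet_derivative h (at x)) (at x)"
    if "x \<in> S" "h differentiable (at x)" "\<And>y. y \<in> S \<Longrightarrow> g y = h y + d" for g h :: "'a \<Rightarrow> real" and x d
  proof -
    have "((\<lambda>y. h y + d) has_derivative frechet_derivative h (at x)) (at x)"
      using that(2) by (intro has_derivative_add_const) (simp add: frechet_derivative_works)
    then show ?thesis
      by (rule has_derivative_transform_within_open[OF _ assms(1) that(1)]) (use that(3) in simp)
  qed
  have first: "f differentiable (at x)" "pderivative i f x = pderivative i u x" if "x \<in> S" for x i
  proof -
    have D: "(f has_derivative frechet_derivative u (at x)) (at x)"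
      by (rule *[OF that _ assms(3)]) (use assms(2) that in \<open>auto simp: C2_on_def\<close>)
    show "f differentiable (at x)" using D by (rule differentiableI)
    show "pderivative i f x = pderivative i u x"
      using frechet_derivative_at[OF D] by (simp add: pderivative_def)
  qed
  have second: "pderivative i f differentiable (at x)"
    "pderivative j (pderivative i f) x = pderivative j (pderivative i u) x"
    if "x \<in> S" "i \<in> Basis" for x i j
  proof -
    have D: "(pderivative i f has_derivative frechet_derivative (pderivative i u) (at x)) (at x)"
      by (rule *[OF that(1), where d = 0]) (use assms(2) that first(2) in \<open>auto simp: C2_on_def\<close>)
    show "pderivative i f differentiable (at x)" using D by (rule differentiableI)
    show "pderivative j (pderivative i f) x = pderivative j (pderivative i u) x"
      using frechet_derivative_at[OF D] by (simp add: pderivative_def[of j])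
  qed
  show "C2_on S f"
    using assms(2) first second by (auto simp: C2_on_def cong: continuous_on_cong)
  show "gradient f x = gradient u x" if "x \<in> S"
    using first(2)[OF that] by (simp add: gradient_def)
  show "laplacian f x = laplacian u x" if "x \<in> S"
    using second(2)[OF that] by (simp add: laplacian_def)
qed

section \<open>Radial solutions of the system\<close>

lemma power_minus_one_eq_powr:
  fixes r :: real
  assumes "r > 0" "Suc 0 \<le> n"
  shows "r ^ (n - 1) = r powr (real n - 1)"
  using powr_realpow[OF assms(1), of "n - 1"] assms(2) by (simp add: of_nat_diff)

lemma profile_quadrature:
  fixes v w :: "real \<Rightarrow> real"
  assumes I: "is_interval I" "I \<subseteq> {0<..}"
    and v: "\<And>r. r \<in> I \<Longrightarrow> (v has_real_derivative deriv v r) (at r)"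
    and w: "continuous_on I w" "\<And>r. r \<in> I \<Longrightarrow> w r = r ^ n * deriv v r"
    and ab: "a \<in> I" "b \<in> I"
  shows "interval_lebesgue_integrable lborel (ereal a) (ereal b) (\<lambda>s. w s / s ^ n)"
    and "v b = v a + (LBINT s=ereal a..ereal b. w s / s ^ n)"
proof -
  have sub: "{min a b..max a b} \<subseteq> I"
  proof
    have ends: "min a b \<in> I" "max a b \<in> I" using ab by (simp_all add: min_def max_def)
    fix x assume "x \<in> {min a b..max a b}"
    then show "x \<in> I" using mem_is_interval_1_I[OF I(1) ends] by simp
  qed
  have deriv_eq: "w s / s ^ n = deriv v s" if "s \<in> I" for s
  proof -
    have "s > 0" using I(2) that by auto
    then show ?thesis by (simp add: w(2)[OF that])
  qed
  have "continuous_on I (\<lambda>s. w s / s ^ n)"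
    using I(2) by (intro continuous_intros w(1)) auto
  then have cont: "continuous_on {min a b..max a b} (\<lambda>s. w s / s ^ n)"
    by (rule continuous_on_subset[OF _ sub])
  show "interval_lebesgue_integrable lborel (ereal a) (ereal b) (\<lambda>s. w s / s ^ n)"
    unfolding interval_lebesgue_integrable_iff_Icc by (rule borel_integrable_atLeastAtMost'[OF cont])
  have "(LBINT s=ereal a..ereal b. w s / s ^ n) = v b - v a"
  proof (rule interval_integral_FTC_finite[OF cont])
    fix s assume "min a b \<le> s" "s \<le> max a b"
    then have "s \<in> I" using sub by auto
    then have "(v has_real_derivative w s / s ^ n) (at s within {min a b..max a b})"
      using has_field_derivative_at_within[OF v] deriv_eq by simp
    then show "(v has_vector_derivative w s / s ^ n) (at s within {min a b..max a b})"
      by (simp add: has_real_derivative_iff_has_vector_derivative)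
  qed
  then show "v b = v a + (LBINT s=ereal a..ereal b. w s / s ^ n)" by simp
qed

locale radial_system =
  fixes u1 u2 :: "'a::euclidean_space \<Rightarrow> real" and v1 v2 :: "real \<Rightarrow> real"
    and I :: "real set" and q :: real
  assumes q: "q > 1"
    and interval: "open I" "is_interval I" "I \<subseteq> {0<..}"
    and profiles: "radial_profile {x. norm x \<in> I} u1 v1" "radial_profile {x. norm x \<in> I} u2 v2"
    and solution: "system_solution q q {x. norm x \<in> I} u1 u2"
begin

sublocale u1: radial_C2 u1 v1 I
  using interval profiles(1) solution by unfold_locales (auto simp: system_solution_def)

sublocale u2: radial_C2 u2 v2 I
  using interval profiles(2) solution by unfold_locales (auto simp: system_solution_def)

text \<open>
  The exponent of the weight comes from \<open>r\<^bsup>N-1\<^esup> |y|\<^sup>q = r\<^bsup>(N-1)(1-q)\<^esup> |r\<^bsup>N-1\<^esup> y|\<^sup>q\<close>.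
\<close>

lemma flux_equation:
  assumes r: "r \<in> I" and y: "norm (gradient f (r *\<^sub>R e)) = \<bar>y\<bar>"
    and eq: "- laplacian g (r *\<^sub>R e) = norm (gradient f (r *\<^sub>R e)) powr q"
  shows "r ^ (DIM('a) - 1) * laplacian g (r *\<^sub>R e :: 'a) =
    - (r powr ((real DIM('a) - 1) * (1 - q)) * \<bar>r ^ (DIM('a) - 1) * y\<bar> powr q)"
proof -
  have pos: "r > 0" using interval(3) r by auto
  define m where "m = real DIM('a) - 1"
  have pow: "r ^ (DIM('a) - 1) = r powr m"
    using power_minus_one_eq_powr[OF pos DIM_ge_Suc0] by (simp add: m_def)
  have "r powr (m * (1 - q)) * \<bar>r powr m * y\<bar> powr q = r powr (m * (1 - q) + m * q) * \<bar>y\<bar> powr q"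
    by (simp add: abs_mult powr_mult powr_powr powr_add)
  also have "m * (1 - q) + m * q = m" by (simp add: algebra_simps)
  finally have "r powr (m * (1 - q)) * \<bar>r powr m * y\<bar> powr q = r powr m * \<bar>y\<bar> powr q" .
  moreover have "laplacian g (r *\<^sub>R e) = - (\<bar>y\<bar> powr q)" using eq unfolding y by linarith
  ultimately show ?thesis unfolding pow m_def[symmetric] by simp
qed

sublocale flux_system q I "\<lambda>r. r powr ((real DIM('a) - 1) * (1 - q))"
  "\<lambda>r. r ^ (DIM('a) - 1) * deriv v1 r" "\<lambda>r. r ^ (DIM('a) - 1) * deriv v2 r"
proof
  fix r assume r: "r \<in> I"
  obtain e :: 'a where e: "e \<in> Basis" using nonempty_Basis by blast
  have re: "norm (r *\<^sub>R e) \<in> I" "norm (r *\<^sub>R e) = r"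
    using u1.norm_ray[OF e r] r by simp_all
  have sol: "- laplacian u1 (r *\<^sub>R e) = norm (gradient u2 (r *\<^sub>R e)) powr q"
    "- laplacian u2 (r *\<^sub>R e) = norm (gradient u1 (r *\<^sub>R e)) powr q"
    using solution re(1) unfolding system_solution_def by blast+
  show "((\<lambda>r. r ^ (DIM('a) - 1) * deriv v1 r) has_real_derivative
      - (r powr ((real DIM('a) - 1) * (1 - q)) * \<bar>r ^ (DIM('a) - 1) * deriv v2 r\<bar> powr q)) (at r)"
    using u1.has_real_derivative_flux[OF e r] flux_equation[OF r _ sol(1)]
      u2.norm_gradient_radial[OF re(1)] re(2) by simp
  show "((\<lambda>r. r ^ (DIM('a) - 1) * deriv v2 r) has_real_derivative
      - (r powr ((real DIM('a) - 1) * (1 - q)) * \<bar>r ^ (DIM('a) - 1) * deriv v1 r\<bar> powr q)) (at r)"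
    using u2.has_real_derivative_flux[OF e r] flux_equation[OF r _ sol(2)]
      u1.norm_gradient_radial[OF re(1)] re(2) by simp
  show "0 < r powr ((real DIM('a) - 1) * (1 - q))" using interval(3) r by auto
next
  show "continuous_on I (\<lambda>r. r powr ((real DIM('a) - 1) * (1 - q)))"
    using interval(3) by (intro continuous_intros) auto
qed (use q interval in auto)

lemma first_integral_profile:
  assumes r: "r \<in> I"
    and C: "\<bar>r ^ (DIM('a) - 1) * deriv v1 r\<bar> powr q * (r ^ (DIM('a) - 1) * deriv v1 r) -
      \<bar>r ^ (DIM('a) - 1) * deriv v2 r\<bar> powr q * (r ^ (DIM('a) - 1) * deriv v2 r) = C"
  shows "\<bar>deriv v1 r\<bar> powr q * deriv v1 r - \<bar>deriv v2 r\<bar> powr q * deriv v2 r =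
    C * r powr ((1 - real DIM('a)) * (q + 1))"
proof -
  have pos: "r > 0" using interval(3) r by auto
  define m where "m = real DIM('a) - 1"
  have pow: "r ^ (DIM('a) - 1) = r powr m"
    using power_minus_one_eq_powr[OF pos DIM_ge_Suc0] by (simp add: m_def)
  have *: "\<bar>r powr m * y\<bar> powr q * (r powr m * y) = r powr (m * (q + 1)) * (\<bar>y\<bar> powr q * y)" for y
    by (simp add: abs_mult powr_mult powr_powr powr_add distrib_left mult_ac)
  have "C = r powr (m * (q + 1)) * (\<bar>deriv v1 r\<bar> powr q * deriv v1 r - \<bar>deriv v2 r\<bar> powr q * deriv v2 r)"
    using C unfolding pow * by (simp add: right_diff_distrib)
  moreover have "r powr ((1 - real DIM('a)) * (q + 1)) = inverse (r powr (m * (q + 1)))"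
    by (simp add: m_def powr_minus[symmetric] minus_mult_left)
  ultimately show ?thesis using pos by simp
qed

lemma given_by_quadratures:
  assumes C: "\<And>r. r \<in> I \<Longrightarrow>
      \<bar>r ^ (DIM('a) - 1) * deriv v1 r\<bar> powr q * (r ^ (DIM('a) - 1) * deriv v1 r) -
      \<bar>r ^ (DIM('a) - 1) * deriv v2 r\<bar> powr q * (r ^ (DIM('a) - 1) * deriv v2 r) = C"
  shows "given_by_quadratures DIM('a) q I C v1 v2"
  unfolding given_by_quadratures_def
proof (intro ballI exI conjI allI)
  fix r0 r y assume r: "r0 \<in> I" "r \<in> I"
  let ?w1 = "\<lambda>r. r ^ (DIM('a) - 1) * deriv v1 r" and ?w2 = "\<lambda>r. r ^ (DIM('a) - 1) * deriv v2 r"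
  show "flux_quadrature DIM('a) q C r0 (?w1 r0) r y \<longleftrightarrow> y = ?w1 r"
    by (rule flux_quadrature_iff[OF refl C r])
  have "\<bar>?w1 r\<bar> powr q * ?w1 r - C = \<bar>?w2 r\<bar> powr q * ?w2 r" using C[OF r(2)] by linarith
  then show "?w2 r = signed_root (q + 1) (\<bar>?w1 r\<bar> powr q * ?w1 r - C)"
    using signed_root_odd_powr[of q "?w2 r"] q by simp
  show "interval_lebesgue_integrable lborel (ereal r0) (ereal r) (\<lambda>s. ?w1 s / s ^ (DIM('a) - 1))"
    "v1 r = v1 r0 + (LBINT s=ereal r0..ereal r. ?w1 s / s ^ (DIM('a) - 1))"
    by (rule profile_quadrature[OF interval(2,3) u1.has_real_derivative_profile(1) continuous_w(1) refl r];
        assumption)+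
  show "interval_lebesgue_integrable lborel (ereal r0) (ereal r) (\<lambda>s. ?w2 s / s ^ (DIM('a) - 1))"
    "v2 r = v2 r0 + (LBINT s=ereal r0..ereal r. ?w2 s / s ^ (DIM('a) - 1))"
    by (rule profile_quadrature[OF interval(2,3) u2.has_real_derivative_profile(1) continuous_w(2) refl r];
        assumption)+
qed

text \<open>
  On the whole half-line the constant of the first integral is \<open>0\<close>. Signed powers are injective, so
  the two profiles have the same derivative.
\<close>

lemma profiles_differ_by_constant:
  assumes "I = {0<..}"
  obtains c where "\<And>r. r > 0 \<Longrightarrow> v2 r = v1 r + c"
proof -
  obtain C where C: "\<And>r. r \<in> I \<Longrightarrow>
      \<bar>r ^ (DIM('a) - 1) * deriv v1 r\<bar> powr q * (r ^ (DIM('a) - 1) * deriv v1 r) -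
      \<bar>r ^ (DIM('a) - 1) * deriv v2 r\<bar> powr q * (r ^ (DIM('a) - 1) * deriv v2 r) = C"
    using first_integral by blast
  have "C = 0" by (rule constant_zero_of_global[OF assms refl C])
  have "deriv v1 r = deriv v2 r" if "r \<in> I" for r
    using first_integral_profile[OF that C[OF that]] q odd_powr_eq_iff[of q "deriv v1 r" "deriv v2 r"]
    by (simp add: \<open>C = 0\<close>)
  then have "((\<lambda>r. v2 r - v1 r) has_real_derivative 0) (at r within I)" if "r \<in> I" for r
    using DERIV_diff[OF u2.has_real_derivative_profile(1)[OF that] u1.has_real_derivative_profile(1)[OF that]]
      that by (auto intro: has_field_derivative_at_within)
  then obtain c where "\<forall>r\<in>I. v2 r - v1 r = c"
    using has_field_derivative_zero_constant[OF is_interval_convex[OF interval(2)]] by blast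
  then show thesis using that[of c] assms by (simp add: algebra_simps)
qed

end

theorem proposition5p1:
  fixes q :: real
  assumes "DIM('a::euclidean_space) \<ge> 3" and "q > 1"
  shows
    "(\<forall>(u1::'a \<Rightarrow> real) (u2::'a \<Rightarrow> real) v1 v2 I.
        open I \<and> is_interval I \<and> I \<subseteq> {0<..} \<and>
        radial_profile {x. norm x \<in> I} u1 v1 \<and> radial_profile {x. norm x \<in> I} u2 v2 \<and>
        system_solution q q {x. norm x \<in> I} u1 u2 \<longrightarrow>
        (\<exists>C. (\<forall>r\<in>I. v1 differentiable (at r) \<and> v2 differentiable (at r) \<and>
                \<bar>deriv v1 r\<bar> powr q * deriv v1 r - \<bar>deriv v2 r\<bar> powr q * deriv v2 r
                  = C * r powr ((1 - real DIM('a)) * (q + 1))) \<and>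
             given_by_quadratures DIM('a) q I C v1 v2)) \<and>
     (\<forall>(u1::'a \<Rightarrow> real) (u2::'a \<Rightarrow> real).
        radial_on (- {0}) u1 \<and> radial_on (- {0}) u2 \<and> system_solution q q (- {0}) u1 u2 \<longleftrightarrow>
        (\<exists>u c1 c2. radial_on (- {0}) u \<and> scalar_solution q (- {0}) u \<and>
           (\<forall>x\<in>- {0}. u1 x = u x + c1 \<and> u2 x = u x + c2)))"
proof (intro conjI allI impI iffI)
  fix u1 u2 :: "'a \<Rightarrow> real" and v1 v2 I
  assume "open I \<and> is_interval I \<and> I \<subseteq> {0<..} \<and>
    radial_profile {x. norm x \<in> I} u1 v1 \<and> radial_profile {x. norm x \<in> I} u2 v2 \<and>
    system_solution q q {x. norm x \<in> I} u1 u2"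
  then interpret radial_system u1 u2 v1 v2 I q
    using \<open>q > 1\<close> by unfold_locales auto
  obtain C where C: "\<And>r. r \<in> I \<Longrightarrow>
      \<bar>r ^ (DIM('a) - 1) * deriv v1 r\<bar> powr q * (r ^ (DIM('a) - 1) * deriv v1 r) -
      \<bar>r ^ (DIM('a) - 1) * deriv v2 r\<bar> powr q * (r ^ (DIM('a) - 1) * deriv v2 r) = C"
    using first_integral by blast
  have "v1 differentiable (at r)" "v2 differentiable (at r)" if "r \<in> I" for r
    using u1.has_real_derivative_profile(1)[OF that] u2.has_real_derivative_profile(1)[OF that]
    by (auto simp: real_differentiable_def)
  then show "\<exists>C. (\<forall>r\<in>I. v1 differentiable (at r) \<and> v2 differentiable (at r) \<and>
        \<bar>deriv v1 r\<bar> powr q * deriv v1 r - \<bar>deriv v2 r\<bar> powr q * deriv v2 r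
          = C * r powr ((1 - real DIM('a)) * (q + 1))) \<and>
      given_by_quadratures DIM('a) q I C v1 v2"
    using first_integral_profile[OF _ C] given_by_quadratures[OF C] by blast
next
  fix u1 u2 :: "'a \<Rightarrow> real"
  assume sys: "radial_on (- {0}) u1 \<and> radial_on (- {0}) u2 \<and> system_solution q q (- {0}) u1 u2"
  have punctured: "- {0} = {x::'a. norm x \<in> {0<..}}" by auto
  obtain v1 v2 where v: "radial_profile (- {0}) u1 v1" "radial_profile (- {0}) u2 v2"
    using sys by (auto simp: radial_on_def)
  then interpret radial_system u1 u2 v1 v2 "{0<..}" q
    using sys \<open>q > 1\<close> unfolding punctured by unfold_locales (auto simp: is_interval_convex_1)
  obtain c where c: "\<And>r. r > 0 \<Longrightarrow> v2 r = v1 r + c"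
    using profiles_differ_by_constant by blast
  have u2: "u2 x = u1 x + c" if "x \<in> - {0}" for x
    using v c[of "norm x"] that by (simp add: radial_profile_def)
  have C2: "C2_on (- {0}) u1" using sys by (simp add: system_solution_def)
  have "gradient u2 x = gradient u1 x" if "x \<in> - {0}" for x
    by (rule differential_operators_add_const(2)[OF _ C2 u2 that]) auto
  then have "scalar_solution q (- {0}) u1"
    using sys C2 by (auto simp: system_solution_def scalar_solution_def)
  then show "\<exists>u c1 c2. radial_on (- {0}) u \<and> scalar_solution q (- {0}) u \<and>
      (\<forall>x\<in>- {0}. u1 x = u x + c1 \<and> u2 x = u x + c2)"
    using sys u2 by (intro exI[of _ u1] exI[of _ 0] exI[of _ c]) auto
next
  fix u1 u2 :: "'a \<Rightarrow> real"
  assume "\<exists>u c1 c2. radial_on (- {0}) u \<and> scalar_solution q (- {0}) u \<and>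
      (\<forall>x\<in>- {0}. u1 x = u x + c1 \<and> u2 x = u x + c2)"
  then obtain u c1 c2 v where v: "radial_profile (- {0}) u v" and u: "scalar_solution q (- {0}) u"
    and u1: "\<And>x. x \<in> - {0} \<Longrightarrow> u1 x = u x + c1" and u2: "\<And>x. x \<in> - {0} \<Longrightarrow> u2 x = u x + c2"
    by (auto simp: radial_on_def)
  have op: "open (- {0::'a})" by auto
  have C2: "C2_on (- {0}) u" using u by (simp add: scalar_solution_def)
  note d1 = differential_operators_add_const[OF op C2 u1]
    and d2 = differential_operators_add_const[OF op C2 u2]
  show "radial_on (- {0}) u1"
    unfolding radial_on_def
    by (rule exI[of _ "\<lambda>r. v r + c1"]) (use v u1 in \<open>simp add: radial_profile_def\<close>)
  show "radial_on (- {0}) u2"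
    unfolding radial_on_def
    by (rule exI[of _ "\<lambda>r. v r + c2"]) (use v u2 in \<open>simp add: radial_profile_def\<close>)
  show "system_solution q q (- {0}) u1 u2"
    unfolding system_solution_def
  proof (intro conjI ballI)
    show "C2_on (- {0}) u1" "C2_on (- {0}) u2" by (rule d1(1) d2(1); assumption)+
    fix x :: 'a assume x: "x \<in> - {0}"
    have "- laplacian u x = norm (gradient u x) powr q" using u x by (simp add: scalar_solution_def)
    then show "- laplacian u1 x = norm (gradient u2 x) powr q"
      "- laplacian u2 x = norm (gradient u1 x) powr q"
      using d1(2,3)[OF _ x] d2(2,3)[OF _ x] by simp_all
  qed
qed

end
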